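(* Let $\Lambda\subset\mathbb{R}^3$ be a simply connected open domain on which $x_1\neq0$ and $x_2\neq0$, and let $\overline u=u_0-iu_1-ju_2:\Lambda\to\mathbb{R}^3$ be a harmonic meridional mapping of the second kind. Put $u_\rho=\frac{u_1}{x_1}\rho=\frac{u_2}{x_2}\rho$. Then the set of degenerate points of $\overline u$ is the set of points of $\Lambda$ at which at least one of the following two equations holds: $$u_\rho=0,\qquad \left(\frac{\partial u_\rho}{\partial x_0}\right)^2+\left(\frac{\partial u_\rho}{\partial\rho}\right)^2+\frac{u_\rho}{\rho}\frac{\partial u_\rho}{\partial\rho}=0.$$
   Context: Here $\mathbb{R}^3=\{(x_0,x_1,x_2)\}$ is identified with the reduced quaternions $x_0+ix_1+jx_2$; cylindrical coordinates $(x_0,\theta,\rho)$ are given by $x_1=\rho\cos\theta$, $x_2=\rho\sin\theta$, $\rho=\sqrt{x_1^2+x_2^2}$, and $\partial/\partial x_0,\partial/\partial\rho$ of $u_\rho$ are taken in these coordinates. The system $(R)$ for real-valued functions $(u_0,u_1,u_2)$ of $(x_0,x_1,x_2)$ is $$\frac{\partial u_0}{\partial x_0}-\frac{\partial u_1}{\partial x_1}-\frac{\partial u_2}{\partial x_2}=0,\quad \frac{\partial u_0}{\partial x_1}=-\frac{\partial u_1}{\partial x_0},\quad \frac{\partial u_0}{\partial x_2}=-\frac{\partial u_2}{\partial x_0},\quad \frac{\partial u_1}{\partial x_2}=\frac{\partial u_2}{\partial x_1}.$$ If $(u_0,u_1,u_2)$ is a solution of $(R)$ in $\Lambda$ with $x_2u_1=x_1u_2$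 in $\Lambda$, then the mapping $\overline u=u_0-iu_1-ju_2:\Lambda\to\mathbb{R}^3$, i.e. $x\mapsto(u_0,-u_1,-u_2)$, is called a harmonic meridional mapping of the second kind. A degenerate point of $\overline u$ is a point of $\Lambda$ where the determinant of its $3\times3$ Jacobian matrix with respect to $(x_0,x_1,x_2)$ is zero. *)

theory Defs
  imports "HOL-Analysis.Analysis"
begin

text \<open>
  A point \<open>x :: real^3\<close> stands for the reduced quaternion \<open>x0 + i x1 + j x2\<close>. Vector components
  are numbered from 1, so \<open>x0 = x$1\<close>, \<open>x1 = x$2\<close> and \<open>x2 = x$3\<close>.
\<close>

definition partial :: "3 \<Rightarrow> (real^3 \<Rightarrow> real) \<Rightarrow> real^3 \<Rightarrow> real" where
  "partial i f x = deriv (\<lambda>t. f (x + t *\<^sub>R axis i 1)) 0"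

text \<open>
  Solutions are classical: the three functions are (totally) differentiable at each point.
  Continuity of the derivatives is not required.
\<close>

definition solution_R ::
  "(real^3) set \<Rightarrow> (real^3 \<Rightarrow> real) \<Rightarrow> (real^3 \<Rightarrow> real) \<Rightarrow> (real^3 \<Rightarrow> real) \<Rightarrow> bool" where
  "solution_R \<Lambda> u0 u1 u2 \<longleftrightarrow>
    (\<forall>x\<in>\<Lambda>. u0 differentiable (at x) \<and> u1 differentiable (at x) \<and> u2 differentiable (at x) \<and>
      partial 1 u0 x - partial 2 u1 x - partial 3 u2 x = 0 \<and>
      partial 2 u0 x = - partial 1 u1 x \<and>
      partial 3 u0 x = - partial 1 u2 x \<and>
      partial 3 u1 x = partial 2 u2 x)"

definition conj_map ::
  "(real^3 \<Rightarrow> real) \<Rightarrow> (real^3 \<Rightarrow> real) \<Rightarrow> (real^3 \<Rightarrow> real) \<Rightarrow> real^3 \<Rightarrow> real^3" where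
  "conj_map u0 u1 u2 x = vector [u0 x, - u1 x, - u2 x]"

text \<open>
  The property is stated for the components; the mapping itself is \<open>conj_map u0 u1 u2\<close>.
\<close>

definition harmonic_meridional_second_kind ::
  "(real^3) set \<Rightarrow> (real^3 \<Rightarrow> real) \<Rightarrow> (real^3 \<Rightarrow> real) \<Rightarrow> (real^3 \<Rightarrow> real) \<Rightarrow> bool" where
  "harmonic_meridional_second_kind \<Lambda> u0 u1 u2 \<longleftrightarrow>
    solution_R \<Lambda> u0 u1 u2 \<and> (\<forall>x\<in>\<Lambda>. x$3 * u1 x = x$2 * u2 x)"

definition degenerate_points :: "(real^3) set \<Rightarrow> (real^3 \<Rightarrow> real^3) \<Rightarrow> (real^3) set" where
  "degenerate_points \<Lambda> f = {x \<in> \<Lambda>. det (jacobian f (at x)) = 0}"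

definition cyl :: "real \<Rightarrow> real \<Rightarrow> real \<Rightarrow> real^3" where
  "cyl x0 \<theta> \<rho> = vector [x0, \<rho> * cos \<theta>, \<rho> * sin \<theta>]"

definition rho :: "real^3 \<Rightarrow> real" where
  "rho x = sqrt ((x$2)\<^sup>2 + (x$3)\<^sup>2)"

text \<open>
  The angle is normalised to the interval from \<open>-\<pi>\<close> (excluded) to \<open>\<pi>\<close> (included). The
  derivatives below are taken at fixed angle, so they do not depend on this choice.
\<close>

definition theta :: "real^3 \<Rightarrow> real" where
  "theta x = Arg (Complex (x$2) (x$3))"

definition cyl_partial_x0 :: "(real^3 \<Rightarrow> real) \<Rightarrow> real^3 \<Rightarrow> real" where
  "cyl_partial_x0 f x = deriv (\<lambda>t. f (cyl t (theta x) (rho x))) (x$1)"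

definition cyl_partial_rho :: "(real^3 \<Rightarrow> real) \<Rightarrow> real^3 \<Rightarrow> real" where
  "cyl_partial_rho f x = deriv (\<lambda>r. f (cyl (x$1) (theta x) r)) (rho x)"

definition u_rho :: "(real^3 \<Rightarrow> real) \<Rightarrow> real^3 \<Rightarrow> real" where
  "u_rho u1 x = u1 x / x$2 * rho x"

end

theory Submission
  imports Defs
begin

text \<open>
  Write \<open>u1 = x1 w\<close>, \<open>u2 = x2 w\<close>, so \<open>u\<^sub>\<rho> = \<rho> w\<close>. The last equation of the system makes the
  \<open>(x1, x2)\<close>-gradient of \<open>w\<close> a multiple \<open>k (x1, x2)\<close> of the position vector. With \<open>q = \<partial>w/\<partial>x0\<close>
  this gives \<open>\<partial>u\<^sub>\<rho>/\<partial>x0 = \<rho> q\<close> and \<open>D = \<partial>u\<^sub>\<rho>/\<partial>\<rho> = w + k \<rho>\<^sup>2\<close>, and the first equation reads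
  \<open>\<partial>u0/\<partial>x0 = w + D\<close>. Expanding the Jacobian determinant gives \<open>w ((w + D) D + \<rho>\<^sup>2 q\<^sup>2)\<close>.
\<close>

text \<open>The chain rule along an affine line through \<open>x\<close>. The parameter passes
  \<open>x\<close> at \<open>s\<close> instead of 0, so that one lemma serves \<open>partial\<close>
  (\<open>s = 0\<close>) as well as both cylindrical derivatives, which are taken at
  \<open>x$1\<close> and at \<open>rho x\<close>.\<close>

lemma deriv_along_line:
  fixes f :: "'a::real_normed_vector \<Rightarrow> real"
  assumes "(f has_derivative f') (at x)"
  shows "deriv (\<lambda>t. f (x + (t - s) *\<^sub>R v)) s = f' v"
proof -
  have "((\<lambda>t. x + (t - s) *\<^sub>R v) has_derivative (\<lambda>h. h *\<^sub>R v)) (at s)"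
    by (auto intro!: derivative_eq_intros)
  then have "((\<lambda>t. f (x + (t - s) *\<^sub>R v)) has_derivative (\<lambda>h. f' (h *\<^sub>R v))) (at s)"
    by (rule has_derivative_compose) (use assms in simp)
  moreover have "(\<lambda>h. f' (h *\<^sub>R v)) = (*) (f' v)"
    using linear_cmul[OF has_derivative_linear[OF assms]] by (auto simp: fun_eq_iff)
  ultimately show ?thesis
    by (auto simp: has_field_derivative_def intro: DERIV_imp_deriv)
qed

lemma partial_eq:
  assumes "(f has_derivative f') (at x)"
  shows "partial i f x = f' (axis i 1)"
  using deriv_along_line[OF assms, of 0 "axis i 1"] by (simp add: partial_def)

lemma rho_cos_theta: "rho x * cos (theta x) = x$2"
  and rho_sin_theta: "rho x * sin (theta x) = x$3"
proof -
  let ?z = "Complex (x$2) (x$3)"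
  have "rcis (rho x) (theta x) = ?z"
    using rcis_cmod_Arg[of ?z] by (simp add: rho_def theta_def complex_norm)
  then show "rho x * cos (theta x) = x$2" "rho x * sin (theta x) = x$3"
    by (simp_all add: complex_eq_iff)
qed

lemma cyl_partial_x0_eq:
  assumes "(f has_derivative f') (at x)"
  shows "cyl_partial_x0 f x = f' (axis 1 1)"
proof -
  have "cyl t (theta x) (rho x) = x + (t - x$1) *\<^sub>R axis 1 1" for t
    by (simp add: cyl_def vec_eq_iff forall_3 axis_def rho_cos_theta rho_sin_theta)
  then show ?thesis
    using deriv_along_line[OF assms] by (simp add: cyl_partial_x0_def)
qed

text \<open>With the angle fixed, the \<rho>-coordinate curve is a straight line through
  \<open>x\<close> with the radial unit vector as direction, so a total derivative can simply be
  evaluated there.\<close>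

lemma cyl_partial_rho_eq:
  assumes "(f has_derivative f') (at x)"
  shows "cyl_partial_rho f x = f' (vector [0, cos (theta x), sin (theta x)])"
proof -
  have "cyl (x$1) (theta x) r = x + (r - rho x) *\<^sub>R vector [0, cos (theta x), sin (theta x)]" for r
    by (simp add: cyl_def vec_eq_iff forall_3 left_diff_distrib rho_cos_theta rho_sin_theta)
  then show ?thesis
    using deriv_along_line[OF assms] by (simp add: cyl_partial_rho_def)
qed

lemma has_derivative_vec_nth: "((\<lambda>y. y $ i) has_derivative (\<lambda>h. h $ i)) F"
  for F :: "(real^'n) filter"
  by (rule bounded_linear_imp_has_derivative[OF bounded_linear_vec_nth])

lemma has_derivative_rho:
  assumes "rho x \<noteq> 0"
  shows "(rho has_derivative (\<lambda>h. (x$2 * h$2 + x$3 * h$3) / rho x)) (at x)"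
proof -
  have "(x$2)\<^sup>2 + (x$3)\<^sup>2 > 0"
    using assms by (simp add: rho_def sum_power2_gt_zero_iff)
  moreover have "((\<lambda>y. (y$2)\<^sup>2 + (y$3)\<^sup>2) has_derivative
      (\<lambda>h. 2 * (x$2 * h$2 + x$3 * h$3))) (at x)"
    by (auto intro!: derivative_eq_intros has_derivative_vec_nth simp: fun_eq_iff)
  ultimately have "(rho has_derivative
      (\<lambda>h. 2 * (x$2 * h$2 + x$3 * h$3) * (inverse (rho x) / 2))) (at x)"
    unfolding rho_def[abs_def] by (rule has_derivative_real_sqrt)
  then show ?thesis
    by (simp add: inverse_eq_divide add_divide_distrib)
qed

lemma has_derivative_conj_map:
  assumes "(u0 has_derivative U0) (at x)" "(u1 has_derivative U1) (at x)"
    "(u2 has_derivative U2) (at x)"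
  shows "(conj_map u0 u1 u2 has_derivative conj_map U0 U1 U2) (at x)"
proof -
  \<comment> \<open>Rewriting the vector as a combination of unit vectors brings it into the form
    that the derivative rules handle.\<close>
  have conj_map_axis: "conj_map f g h =
      (\<lambda>y. f y *\<^sub>R axis 1 1 + (- g y) *\<^sub>R axis 2 1 + (- h y) *\<^sub>R axis 3 1)" for f g h
    by (simp add: fun_eq_iff conj_map_def vec_eq_iff forall_3 axis_def)
  show ?thesis
    unfolding conj_map_axis by (intro derivative_intros assms)
qed

lemma axis_component: "axis i a $ j = (if j = i then a else 0)"
  by (simp add: axis_def)

lemma det_jacobian_conj_map:
  fixes x :: "real^3"
  assumes "open \<Lambda>" "x \<in> \<Lambda>"
    and nz: "\<forall>x\<in>\<Lambda>. x$2 \<noteq> 0 \<and> x$3 \<noteq> 0"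
    and hm: "harmonic_meridional_second_kind \<Lambda> u0 u1 u2"
  shows "det (jacobian (conj_map u0 u1 u2) (at x)) =
    u_rho u1 x / rho x * ((cyl_partial_x0 (u_rho u1) x)\<^sup>2 + (cyl_partial_rho (u_rho u1) x)\<^sup>2
          + u_rho u1 x / rho x * cyl_partial_rho (u_rho u1) x)"
proof -
  have "x$2 \<noteq> 0"
    using nz \<open>x \<in> \<Lambda>\<close> by blast
  define w where "w y = u1 y / y$2" for y
  obtain U0 U1 U2 where U: "(u0 has_derivative U0) (at x)" "(u1 has_derivative U1) (at x)"
    "(u2 has_derivative U2) (at x)"
    using hm \<open>x \<in> \<Lambda>\<close> by (auto simp: harmonic_meridional_second_kind_def solution_R_def differentiable_def)
  have "w differentiable (at x)"
    unfolding w_def[abs_def] using U(2) \<open>x$2 \<noteq> 0\<close>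
    by (intro differentiable_divide) (auto simp: differentiable_def intro: has_derivative_vec_nth)
  then obtain W where W: "(w has_derivative W) (at x)"
    by (auto simp: differentiable_def)
  \<comment> \<open>The meridional condition makes \<open>w\<close> the common quotient of both
    components, although it is defined from \<open>u1\<close> alone.\<close>
  have u1_eq: "y$2 * w y = u1 y" and u2_eq: "y$3 * w y = u2 y" if "y \<in> \<Lambda>" for y
    using that nz hm by (auto simp: w_def harmonic_meridional_second_kind_def field_simps)
  have "((\<lambda>y. y$2 * w y) has_derivative (\<lambda>h. x$2 * W h + h$2 * w x)) (at x)"
    by (auto intro!: derivative_eq_intros has_derivative_vec_nth W)
  \<comment> \<open>The product formula holds only on \<Lambda>; openness carries its derivative
    over to \<open>u1\<close>, and uniqueness then identifies it with \<open>U1\<close>.\<close>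
  then have "(u1 has_derivative (\<lambda>h. x$2 * W h + h$2 * w x)) (at x)"
    by (rule has_derivative_transform_within_open) (use assms u1_eq in auto)
  then have U1: "U1 = (\<lambda>h. x$2 * W h + h$2 * w x)"
    using U(2) has_derivative_unique by blast
  have "((\<lambda>y. y$3 * w y) has_derivative (\<lambda>h. x$3 * W h + h$3 * w x)) (at x)"
    by (auto intro!: derivative_eq_intros has_derivative_vec_nth W)
  then have "(u2 has_derivative (\<lambda>h. x$3 * W h + h$3 * w x)) (at x)"
    by (rule has_derivative_transform_within_open) (use assms u2_eq in auto)
  then have U2: "U2 = (\<lambda>h. x$3 * W h + h$3 * w x)"
    using U(3) has_derivative_unique by blast
  define k where "k = W (axis 2 1) / x$2"
  define q where "q = W (axis 1 1)"
  have R: "U0 (axis 1 1) - U1 (axis 2 1) - U2 (axis 3 1) = 0"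
    "U0 (axis 2 1) = - U1 (axis 1 1)" "U0 (axis 3 1) = - U2 (axis 1 1)"
    "U1 (axis 3 1) = U2 (axis 2 1)"
    unfolding U[THEN partial_eq, symmetric] using hm \<open>x \<in> \<Lambda>\<close>
    by (simp_all add: harmonic_meridional_second_kind_def solution_R_def)
  have W2: "W (axis 2 1) = k * x$2"
    using \<open>x$2 \<noteq> 0\<close> by (simp add: k_def)
  \<comment> \<open>In the last equation of the system the terms without \<open>W\<close> vanish,
    which leaves \<open>x$2 * W (axis 3 1) = x$3 * W (axis 2 1)\<close>.\<close>
  have W3: "W (axis 3 1) = k * x$3"
    using R(4) \<open>x$2 \<noteq> 0\<close> by (simp add: U1 U2 k_def axis_component field_simps)
  define r where "r = rho x"
  have r2: "r\<^sup>2 = (x$2)\<^sup>2 + (x$3)\<^sup>2"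
    by (simp add: r_def rho_def)
  have "r \<noteq> 0"
    using \<open>x$2 \<noteq> 0\<close> by (simp add: r_def rho_def)
  then have cos_sin: "cos (theta x) = x$2 / r" "sin (theta x) = x$3 / r"
    using rho_cos_theta[of x] rho_sin_theta[of x] by (simp_all add: r_def field_simps)
  have u_rho: "u_rho u1 = (\<lambda>y. w y * rho y)"
    by (simp add: fun_eq_iff u_rho_def w_def)
  have ur: "(u_rho u1 has_derivative
      (\<lambda>h. w x * ((x$2 * h$2 + x$3 * h$3) / r) + W h * r)) (at x)"
    unfolding u_rho r_def using \<open>r \<noteq> 0\<close>
    by (intro has_derivative_mult W has_derivative_rho) (simp add: r_def)
  have d0: "cyl_partial_x0 (u_rho u1) x = q * r"
    by (simp add: cyl_partial_x0_eq[OF ur] q_def axis_component)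
  have "vector [0, x$2 / r, x$3 / r] = (x$2 / r) *\<^sub>R axis 2 1 + (x$3 / r) *\<^sub>R (axis 3 1 :: real^3)"
    by (simp add: vec_eq_iff forall_3 axis_component)
  then have "W (vector [0, x$2 / r, x$3 / r]) = x$2 / r * (k * x$2) + x$3 / r * (k * x$3)"
    using has_derivative_linear[OF W] by (simp add: linear_add linear_cmul W2 W3)
  \<comment> \<open>The sum of squares is kept as a factor so that \<open>r2\<close> can fold it
    into \<open>r\<^sup>2\<close> next.\<close>
  then have "cyl_partial_rho (u_rho u1) x = (w x / r\<^sup>2 + k) * ((x$2)\<^sup>2 + (x$3)\<^sup>2)"
    using \<open>r \<noteq> 0\<close> by (simp add: cyl_partial_rho_eq[OF ur] cos_sin) (simp add: field_simps power2_eq_square)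
  also have "\<dots> = w x + k * r\<^sup>2"
    using \<open>r \<noteq> 0\<close> unfolding r2[symmetric] by (simp add: field_simps)
  finally have d\<rho>: "cyl_partial_rho (u_rho u1) x = w x + k * r\<^sup>2" .
  have "frechet_derivative (conj_map u0 u1 u2) (at x) = conj_map U0 U1 U2"
    using has_derivative_conj_map[OF U] by (metis frechet_derivative_at)
  moreover have "U0 (axis 1 1) = 2 * w x + k * r\<^sup>2"
    unfolding r2 using R(1)
    by (simp add: U1 U2 W2 W3 axis_component algebra_simps power2_eq_square)
  moreover have "U1 (axis 1 1) = x$2 * q" "U1 (axis 2 1) = k * (x$2)\<^sup>2 + w x"
    "U1 (axis 3 1) = k * (x$2 * x$3)"
    "U2 (axis 1 1) = x$3 * q" "U2 (axis 2 1) = k * (x$2 * x$3)"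
    "U2 (axis 3 1) = k * (x$3)\<^sup>2 + w x"
    by (simp_all add: U1 U2 W2 W3 axis_component q_def power2_eq_square)
  \<comment> \<open>By \<open>R(2,3)\<close> the Jacobian matrix is symmetric. The first summand is
    its top left entry times the complementary minor; the second collects the terms in
    \<open>q\<^sup>2\<close>.\<close>
  ultimately have "det (jacobian (conj_map u0 u1 u2) (at x)) =
      (2 * w x + k * r\<^sup>2) * ((k * (x$2)\<^sup>2 + w x) * (k * (x$3)\<^sup>2 + w x) - (k * (x$2 * x$3))\<^sup>2)
      + q\<^sup>2 * ((x$2)\<^sup>2 * (k * (x$3)\<^sup>2 + w x) + (x$3)\<^sup>2 * (k * (x$2)\<^sup>2 + w x)
        - 2 * k * (x$2)\<^sup>2 * (x$3)\<^sup>2)"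
    by (simp add: jacobian_def matrix_def det_3 conj_map_def R(2,3))
      (simp add: algebra_simps power2_eq_square)
  \<comment> \<open>In the minor the \<open>k\<^sup>2\<close> terms cancel, leaving
    \<open>w x * (w x + k * r\<^sup>2)\<close>; the factor of \<open>q\<^sup>2\<close> collapses to
    \<open>w x * r\<^sup>2\<close>.\<close>
  also have "\<dots> = w x * ((q * r)\<^sup>2 + (w x + k * r\<^sup>2)\<^sup>2 + w x * (w x + k * r\<^sup>2))"
    using r2 by algebra
  finally have "det (jacobian (conj_map u0 u1 u2) (at x)) =
      w x * ((q * r)\<^sup>2 + (w x + k * r\<^sup>2)\<^sup>2 + w x * (w x + k * r\<^sup>2))" .
  moreover have "u_rho u1 x / rho x = w x"
    using \<open>r \<noteq> 0\<close> by (simp add: u_rho r_def)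
  ultimately show ?thesis
    by (simp add: d0 d\<rho>)
qed

theorem corollary7p3:
  fixes \<Lambda> :: "(real^3) set" and u0 u1 u2 :: "real^3 \<Rightarrow> real"
  assumes "open \<Lambda>" and "simply_connected \<Lambda>"
    and "\<forall>x\<in>\<Lambda>. x$2 \<noteq> 0 \<and> x$3 \<noteq> 0"
    and "harmonic_meridional_second_kind \<Lambda> u0 u1 u2"
  shows "(\<forall>x\<in>\<Lambda>. u_rho u1 x = u2 x / x$3 * rho x) \<and>
    degenerate_points \<Lambda> (conj_map u0 u1 u2) =
      {x \<in> \<Lambda>. u_rho u1 x = 0 \<or>
        (cyl_partial_x0 (u_rho u1) x)\<^sup>2 + (cyl_partial_rho (u_rho u1) x)\<^sup>2
          + u_rho u1 x / rho x * cyl_partial_rho (u_rho u1) x = 0}"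
proof
  show "\<forall>x\<in>\<Lambda>. u_rho u1 x = u2 x / x$3 * rho x"
    using assms(3,4) by (auto simp: u_rho_def harmonic_meridional_second_kind_def field_simps)
  \<comment> \<open>Off the axis, the factor \<open>u_rho u1 x / rho x\<close> of the determinant
    vanishes exactly when \<open>u_rho u1 x\<close> does.\<close>
  have "rho x \<noteq> 0" if "x \<in> \<Lambda>" for x
    using assms(3) that by (simp add: rho_def)
  then show "degenerate_points \<Lambda> (conj_map u0 u1 u2) =
      {x \<in> \<Lambda>. u_rho u1 x = 0 \<or>
        (cyl_partial_x0 (u_rho u1) x)\<^sup>2 + (cyl_partial_rho (u_rho u1) x)\<^sup>2
          + u_rho u1 x / rho x * cyl_partial_rho (u_rho u1) x = 0}"
    using assms by (auto simp: degenerate_points_def det_jacobian_conj_map)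
qed

end
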